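(* There is an absolute constant $C>0$ such that for every integer $n\ge 1$, $$\operatorname{ex}_3(n,\mathrm{BC}_4)\le \frac{n^{3/2}}{2+\sqrt2}+Cn,$$ that is, every $3$-uniform hypergraph on $n$ vertices containing no Berge cycle of length four has at most $\frac{n^{3/2}}{2+\sqrt2}+Cn$ hyperedges.
   Context: A $3$-uniform hypergraph $H$ consists of a finite vertex set $V(H)$ and a set $E(H)$ of $3$-element subsets of $V(H)$, called hyperedges (no repeated hyperedges). A Berge cycle of length $\ell$ in a hypergraph consists of $\ell$ distinct vertices $v_1,\ldots,v_\ell$ and $\ell$ distinct hyperedges $e_1,\ldots,e_\ell$ such that $\{v_i,v_{i+1}\}\subset e_i$ for every $i$, with indices taken modulo $\ell$. The quantity $\operatorname{ex}_r(n,\mathrm{BC}_\ell)$ is the maximum number of hyperedges in an $r$-uniform hypergraph on $n$ vertices that contains no Berge cycle of length $\ell$. *)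

theory Defs
  imports "HOL-Analysis.Analysis"
begin

definition uniform_hypergraph :: "nat \<Rightarrow> 'a set \<Rightarrow> 'a set set \<Rightarrow> bool" where
  "uniform_hypergraph r V E \<longleftrightarrow> finite V \<and> (\<forall>e\<in>E. e \<subseteq> V \<and> card e = r)"

definition berge_cycle :: "'a set \<Rightarrow> 'a set set \<Rightarrow> nat \<Rightarrow> (nat \<Rightarrow> 'a) \<Rightarrow> (nat \<Rightarrow> 'a set) \<Rightarrow> bool" where
  "berge_cycle V E l v e \<longleftrightarrow>
     v ` {..<l} \<subseteq> V \<and> inj_on v {..<l} \<and> e ` {..<l} \<subseteq> E \<and> inj_on e {..<l} \<and>
     (\<forall>i<l. {v i, v (Suc i mod l)} \<subseteq> e i)"

definition berge_cycle_free :: "'a set \<Rightarrow> 'a set set \<Rightarrow> nat \<Rightarrow> bool" where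
  "berge_cycle_free V E l \<longleftrightarrow> (\<nexists>v e. berge_cycle V E l v e)"

text \<open>Vertices are taken to be natural numbers, without loss of generality: see
  \<open>card_le_ex_berge_cycle\<close> for hypergraphs over an arbitrary type. The maximum is over a finite
  set by \<open>finite_hypergraph_sizes\<close>; for \<open>l > 0\<close> that set is nonempty by \<open>hypergraph_sizes_nonempty\<close>.\<close>

definition ex_berge_cycle :: "nat \<Rightarrow> nat \<Rightarrow> nat \<Rightarrow> nat" where
  "ex_berge_cycle r n l =
     Max {card E |(V :: nat set) E. uniform_hypergraph r V E \<and> card V = n \<and> berge_cycle_free V E l}"

lemma card_hyperedges_le:
  assumes "uniform_hypergraph r V E"
  shows "card E \<le> card V choose r"
proof -
  have fin: "finite V" and sub: "E \<subseteq> {e. e \<subseteq> V \<and> card e = r}"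
    using assms by (auto simp: uniform_hypergraph_def)
  have "finite {e. e \<subseteq> V \<and> card e = r}"
    using fin by simp
  from card_mono[OF this sub] show ?thesis
    by (simp add: n_subsets[OF fin])
qed

lemma finite_hypergraph_sizes:
  "finite {card E |(V :: 'a set) E. uniform_hypergraph r V E \<and> card V = n \<and> berge_cycle_free V E l}"
  by (rule finite_subset[of _ "{..n choose r}"]) (auto dest: card_hyperedges_le)

lemma hypergraph_sizes_nonempty:
  assumes "l > 0"
  shows "{card E |(V :: nat set) E. uniform_hypergraph r V E \<and> card V = n \<and> berge_cycle_free V E l} \<noteq> {}"
proof -
  have "uniform_hypergraph r {..<n} {} \<and> card {..<n} = n \<and> berge_cycle_free {..<n} {} l"
    using assms by (auto simp: uniform_hypergraph_def berge_cycle_free_def berge_cycle_def)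
  then show ?thesis by blast
qed

lemma card_le_ex_berge_cycle:
  fixes V :: "'a set"
  assumes H: "uniform_hypergraph r V E" and free: "berge_cycle_free V E l"
  shows "card E \<le> ex_berge_cycle r (card V) l"
proof -
  have fin: "finite V" and sub: "\<And>e. e \<in> E \<Longrightarrow> e \<subseteq> V"
    using H by (auto simp: uniform_hypergraph_def)
  obtain f :: "'a \<Rightarrow> nat" where f: "inj_on f V"
    using finite_imp_inj_to_nat_seg[OF fin] by blast
  define g where "g = inv_into V f"
  have gf: "g (f x) = x" if "x \<in> V" for x
    using that f by (simp add: g_def)
  have gf_im: "g ` f ` e = e" if "e \<in> E" for e
    using sub[OF that] gf by (force simp: image_image subset_iff)
  have inj_im: "inj_on ((`) f) E"
    by (rule inj_on_inverseI[where g = "(`) g"]) (simp add: gf_im)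
  have inj_g: "inj_on g (f ` V)"
    by (simp add: g_def inj_on_inv_into)
  have inj_img: "inj_on ((`) g) ((`) f ` E)"
    by (rule inj_on_inverseI[where g = "(`) f"]) (metis gf_im imageE)
  have hyp: "uniform_hypergraph r (f ` V) ((`) f ` E)"
    using H unfolding uniform_hypergraph_def
    by (auto simp: card_image inj_on_subset[OF f])
  have free': "berge_cycle_free (f ` V) ((`) f ` E) l"
    unfolding berge_cycle_free_def
  proof (rule notI, elim exE)
    fix v e assume c: "berge_cycle (f ` V) ((`) f ` E) l v e"
    then have v: "v ` {..<l} \<subseteq> f ` V" "inj_on v {..<l}"
      and e: "e ` {..<l} \<subseteq> (`) f ` E" "inj_on e {..<l}"
      and inc: "\<And>i. i < l \<Longrightarrow> {v i, v (Suc i mod l)} \<subseteq> e i"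
      by (auto simp: berge_cycle_def)
    have "berge_cycle V E l (g \<circ> v) (\<lambda>i. g ` e i)"
      unfolding berge_cycle_def
    proof (intro conjI allI impI)
      show "(g \<circ> v) ` {..<l} \<subseteq> V"
        using v(1) gf by (force simp: subset_iff image_iff)
      show "inj_on (g \<circ> v) {..<l}"
        using v inj_g by (intro comp_inj_on) (auto intro: inj_on_subset)
      show "(\<lambda>i. g ` e i) ` {..<l} \<subseteq> E"
        using e(1) gf_im by (force simp: subset_iff image_iff)
      have "inj_on ((`) g \<circ> e) {..<l}"
        using e inj_img by (intro comp_inj_on) (auto intro: inj_on_subset)
      then show "inj_on (\<lambda>i. g ` e i) {..<l}"
        by (simp add: comp_def)
      show "{(g \<circ> v) i, (g \<circ> v) (Suc i mod l)} \<subseteq> g ` e i" if "i < l" for i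
        using inc[OF that] by auto
    qed
    with free show False
      by (auto simp: berge_cycle_free_def)
  qed
  have "card ((`) f ` E) \<in> {card E |(W :: nat set) E.
      uniform_hypergraph r W E \<and> card W = card V \<and> berge_cycle_free W E l}"
    using hyp free' card_image[OF f] by blast
  then have "card ((`) f ` E) \<le> ex_berge_cycle r (card V) l"
    unfolding ex_berge_cycle_def by (intro Max_ge finite_hypergraph_sizes)
  then show ?thesis
    by (simp add: card_image[OF inj_im])
qed

end

theory Submission
  imports Defs
begin

text \<open>Let \<open>m\<close> be the number of hyperedges and let \<open>N v\<close> be the degree of \<open>v\<close> in the graph of pairs covered by
  hyperedges (the shadow). Removing hyperedges one by one shows that the shadow has at least \<open>2 * m\<close>
  edges. Since a Berge four-cycle is forbidden, almost every pair of vertices has at most one common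
  neighbour in the shadow. The exceptions, up to \<open>O(m)\<close> many, are pairs of pages of a common book:
  hyperedges \<open>{x, y, z}\<close> through a fixed spine \<open>{x, y}\<close> whose other two pairs lie in no other hyperedge.
  Such a pair of pages has the two common neighbours \<open>x\<close> and \<open>y\<close>. With \<open>D p\<close> the number of pages on
  the spine \<open>p\<close>, counting paths of length two thus gives
  \<open>(\<Sum>v. (N v)\<^sup>2) \<le> n\<^sup>2 + (\<Sum>p. (D p)\<^sup>2) + O(m)\<close>.

  Half of \<open>(D p)\<^sup>2\<close> is charged to each end of \<open>p\<close>. The weights
  \<open>w v = N v - (1 - 1 / sqrt 2) * (\<Sum>p\<ni>v. D p)\<close> satisfy \<open>(w v)\<^sup>2 \<le> (N v)\<^sup>2 - (\<Sum>p\<ni>v. (D p)\<^sup>2) / 2\<close>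
  and have total at least \<open>(2 + sqrt 2) * m\<close>, so the Cauchy-Schwarz inequality finishes the proof.
  The constant arises because a page contributes weight \<open>2\<close> per hyperedge and each of the two
  spine vertices about \<open>1 / sqrt 2\<close>.\<close>

section \<open>Shadow, shared pairs and pages; the setting without Berge four-cycles\<close>

definition shadow :: "'a set set \<Rightarrow> 'a set set" where
  "shadow E = {p. card p = 2 \<and> (\<exists>e\<in>E. p \<subseteq> e)}"

definition shared :: "'a set set \<Rightarrow> 'a set \<Rightarrow> bool" where
  "shared E p \<longleftrightarrow> (\<exists>e\<in>E. \<exists>f\<in>E. e \<noteq> f \<and> p \<subseteq> e \<and> p \<subseteq> f)"

text \<open>A shared spine is demanded so that a hyperedge has at most one spine; unshared outer
  pairs make the page sets of different spines through one vertex disjoint.\<close>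

definition pages :: "'a set set \<Rightarrow> 'a set \<Rightarrow> 'a set" where
  "pages E p = {z. z \<notin> p \<and> insert z p \<in> E \<and> shared E p \<and> (\<forall>x\<in>p. \<not> shared E {x, z})}"

lemma not_sharedD: "\<lbrakk>\<not> shared E p; e \<in> E; f \<in> E; p \<subseteq> e; p \<subseteq> f\<rbrakk> \<Longrightarrow> e = f"
  by (auto simp: shared_def)

lemma card_le_2I:
  assumes "\<And>x y z. \<lbrakk>x \<in> A; y \<in> A; z \<in> A; x \<noteq> y; y \<noteq> z; x \<noteq> z\<rbrakk> \<Longrightarrow> False"
  shows "card A \<le> 2"
proof (rule ccontr)
  assume "\<not> card A \<le> 2"
  then obtain B where "B \<subseteq> A" "card B = 3"
    by (metis not_less_eq_eq numeral_2_eq_2 numeral_3_eq_3 obtain_subset_with_card_n)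
  then show False
    using assms by (auto simp: card_3_iff)
qed

text \<open>The vertex set is left out so that the setting passes directly to subsets of
  \<open>E\<close>, as the induction by removal of hyperedges requires.\<close>

locale berge_C4_free =
  fixes E :: "'a set set"
  assumes finite_edges: "finite E"
    and card_edge: "e \<in> E \<Longrightarrow> card e = 3"
    and no_C4: "\<lbrakk>e1 \<in> E; e2 \<in> E; e3 \<in> E; e4 \<in> E;
      a \<in> e1; b \<in> e1; b \<in> e2; c \<in> e2; c \<in> e3; d \<in> e3; d \<in> e4; a \<in> e4;
      distinct [a, b, c, d]; distinct [e1, e2, e3, e4]\<rbrakk> \<Longrightarrow> False"
begin

section \<open>Hyperedges through a common pair\<close>

lemma finite_edge: "e \<in> E \<Longrightarrow> finite e"
  using card_edge by (metis card.infinite zero_neq_numeral)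

lemma edge_eqI:
  assumes "e \<in> E" "x \<in> e" "y \<in> e" "z \<in> e" "distinct [x, y, z]"
  shows "e = {x, y, z}"
  using card_edge[OF assms(1)] finite_edge[OF assms(1)] assms(2-)
  by (intro card_subset_eq[symmetric]) auto

lemma edge_elem:
  assumes "e \<in> E" "x \<in> e" "y \<in> e" "z \<in> e" "distinct [x, y, z]" "u \<in> e"
  shows "u = x \<or> u = y \<or> u = z"
  using edge_eqI[OF assms(1-5)] assms(6) by auto

lemma edge_obtain_third:
  assumes "e \<in> E" "x \<in> e" "y \<in> e" "x \<noteq> y"
  obtains z where "e = {x, y, z}" "z \<noteq> x" "z \<noteq> y"
proof -
  have "\<not> e \<subseteq> {x, y}"
    using card_edge[OF assms(1)] assms(4) card_mono[of "{x, y}" e] by auto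
  then obtain z where "z \<in> e" "z \<noteq> x" "z \<noteq> y"
    by auto
  then show ?thesis
    using that edge_eqI[OF assms(1-3)] assms(4) by auto
qed

text \<open>Here \<open>e\<close> is arbitrary: of two distinct hyperedges on the pair, at least one
  differs from it.\<close>

lemma sharedE:
  assumes "shared E {x, y}"
  obtains f where "f \<in> E" "f \<noteq> e" "x \<in> f" "y \<in> f"
  using assms unfolding shared_def by (metis insert_subset)

lemma subset_berge_C4_free: "F \<subseteq> E \<Longrightarrow> berge_C4_free F"
  using finite_edges card_edge no_C4
  by unfold_locales (blast intro: finite_subset, blast, meson subsetD)

text \<open>A hyperedge is bad if at least two of its pairs are shared. Two bad hyperedges on a common pair
  force three hyperedges on four vertices.\<close>

lemma two_bad_edges_aux:
  assumes e: "{a, b, c} \<in> E" "{a, b, d} \<in> E" "distinct [a, b, c, d]"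
    and bc: "shared E {b, c}" and bd: "shared E {b, d} \<or> shared E {a, d}"
  shows "{b, c, d} \<in> E"
proof -
  obtain f where f: "f \<in> E" "f \<noteq> {a, b, c}" "b \<in> f" "c \<in> f"
    using bc by (rule sharedE)
  have c: "c \<notin> {a, b, d}" and d: "d \<notin> {a, b, c}"
    using e(3) by auto
  have dist: "distinct [d, c, b, a]"
    using e(3) by auto
  have f': "f \<noteq> {a, b, d}"
    using f(4) c by blast
  have ne: "{a, b, c} \<noteq> {a, b, d}"
    using c by blast
  show ?thesis
    using bd
  proof
    assume "shared E {b, d}"
    then obtain g where g: "g \<in> E" "g \<noteq> {a, b, d}" "b \<in> g" "d \<in> g"
      by (rule sharedE)
    have g': "g \<noteq> {a, b, c}"
      using g(4) d by blast
    \<comment> \<open>Otherwise \<open>b, c, a, d\<close> is a Berge four-cycle through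
      \<open>f\<close>, the two given hyperedges and \<open>g\<close>. So a single hyperedge
      contains \<open>b\<close>, \<open>c\<close> and \<open>d\<close>.\<close>
    have "f = g"
    proof (rule ccontr)
      assume "f \<noteq> g"
      then show False
        using e dist f f' g ne g' no_C4[of f "{a, b, c}" "{a, b, d}" g b c a d] by simp
    qed
    then show ?thesis
      using e dist f g edge_eqI[of f b c d] by simp
  next
    assume "shared E {a, d}"
    then obtain g where g: "g \<in> E" "g \<noteq> {a, b, d}" "a \<in> g" "d \<in> g"
      by (rule sharedE)
    have g': "g \<noteq> {a, b, c}"
      using g(4) d by blast
    \<comment> \<open>This case is contradictory: if equal, \<open>f\<close> would contain four
      vertices; if distinct, \<open>c, b, d, a\<close> is a Berge four-cycle.\<close>
    have "f \<noteq> g"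
    proof
      assume "f = g"
      then show False
        using e dist f g edge_elem[of f a b c d] by simp
    qed
    then show ?thesis
      using e dist f f' g g' ne no_C4[of f "{a, b, d}" g "{a, b, c}" c b d a] by simp
  qed
qed

lemma two_bad_edges:
  assumes e: "{a, b, c} \<in> E" "{a, b, d} \<in> E" "distinct [a, b, c, d]"
    and c: "shared E {a, c} \<or> shared E {b, c}" and d: "shared E {a, d} \<or> shared E {b, d}"
  shows "{b, c, d} \<in> E \<or> {a, c, d} \<in> E"
  using c
proof
  assume "shared E {b, c}"
  then show ?thesis
    using two_bad_edges_aux[of a b c d] e d by auto
next
  assume "shared E {a, c}"
  then show ?thesis
    using two_bad_edges_aux[of b a c d] e d by (auto simp: insert_commute)
qed

text \<open>Any two of the four vertices are joined by a path of length three through the other two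
  that uses all three hyperedges, and \<open>f\<close> closes it to a Berge four-cycle.\<close>

lemma K4_minus_isolated:
  assumes e: "{a, b, c} \<in> E" "{a, b, d} \<in> E" "{b, c, d} \<in> E" "distinct [a, b, c, d]"
    and f: "f \<in> E" "f \<notin> {{a, b, c}, {a, b, d}, {b, c, d}}"
    and xy: "x \<in> f" "y \<in> f" "x \<noteq> y" "{x, y} \<subseteq> {a, b, c, d}"
  shows False
proof -
  have ne: "distinct [{a, b, c}, {b, c, d}, {a, b, d}]" if "distinct [a, b, c, d]" for a b c d :: 'a
  proof -
    have "c \<notin> {a, b, d}" "a \<notin> {b, c, d}"
      using that by auto
    then have "{a, b, c} \<noteq> {a, b, d}" "{a, b, c} \<noteq> {b, c, d}" "{b, c, d} \<noteq> {a, b, d}"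
      by blast+
    then show ?thesis
      by simp
  qed
  have dist: "distinct [d, c, b, a]" if "distinct [a, b, c, d]" for a b c d :: 'a
    using that by auto
  \<comment> \<open>The vertex \<open>b\<close> lies in all three hyperedges, and \<open>a\<close>,
    \<open>c\<close>, \<open>d\<close> play symmetric roles. Up to relabelling, the pair thus
    contains \<open>b\<close> (\<open>I\<close>) or avoids it (\<open>II\<close>).\<close>
  have I: False if "distinct [a, b, c, d]" "{a, b, c} \<in> E" "{a, b, d} \<in> E" "{b, c, d} \<in> E"
      "f \<notin> {{a, b, c}, {a, b, d}, {b, c, d}}" "a \<in> f" "b \<in> f" for a b c d
    using that f(1) ne[OF that(1)] dist[OF that(1)]
      no_C4[of f "{a, b, c}" "{b, c, d}" "{a, b, d}" b a c d] by simp
  have II: False if "distinct [a, b, c, d]" "{a, b, c} \<in> E" "{a, b, d} \<in> E" "{b, c, d} \<in> E"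
      "f \<notin> {{a, b, c}, {a, b, d}, {b, c, d}}" "a \<in> f" "c \<in> f" for a b c d
    using that f(1) ne[OF that(1)] ne[OF that(1), THEN distinct_rev[THEN iffD2]] dist[OF that(1)] no_C4[of f "{b, c, d}" "{a, b, d}" "{a, b, c}" a c d b] by simp
  have perms: "{c, b, a} = {a, b, c}" "{c, b, d} = {b, c, d}" "{b, a, d} = {a, b, d}"
      "{d, b, c} = {b, c, d}" "{d, b, a} = {a, b, d}" "{b, c, a} = {a, b, c}" "{b, a, c} = {a, b, c}"
      "{b, d, c} = {b, c, d}" "{b, d, a} = {a, b, d}"
    by auto
  consider "a \<in> f" "b \<in> f" | "c \<in> f" "b \<in> f" | "d \<in> f" "b \<in> f"
    | "a \<in> f" "c \<in> f" | "a \<in> f" "d \<in> f" | "c \<in> f" "d \<in> f"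
    using xy by auto
  then show False
  proof cases
    case 1 then show ?thesis using I[of a b c d] e f(2) dist[OF e(4)] by (simp add: perms)
  next
    case 2 then show ?thesis using I[of c b a d] e f(2) dist[OF e(4)] by (simp add: perms)
  next
    case 3 then show ?thesis using I[of d b c a] e f(2) dist[OF e(4)] by (simp add: perms)
  next
    case 4 then show ?thesis using II[of a b c d] e f(2) dist[OF e(4)] by (simp add: perms)
  next
    case 5 then show ?thesis using II[of a b d c] e f(2) dist[OF e(4)] by (simp add: perms)
  next
    case 6 then show ?thesis using II[of c b d a] e f(2) dist[OF e(4)] by (simp add: perms)
  qed
qed

lemma finite_shadow: "finite (shadow E)"
proof (rule finite_subset)
  show "shadow E \<subseteq> Pow (\<Union>E)"
    by (auto simp: shadow_def)
  show "finite (Pow (\<Union>E))"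
    using finite_edges finite_edge by auto
qed

lemma doubleton_in_shadow_iff: "{x, y} \<in> shadow E \<longleftrightarrow> x \<noteq> y \<and> (\<exists>e\<in>E. x \<in> e \<and> y \<in> e)"
  by (auto simp: shadow_def card_insert_if)

lemma doubleton_in_shadowI: "\<lbrakk>e \<in> E; x \<in> e; y \<in> e; x \<noteq> y\<rbrakk> \<Longrightarrow> {x, y} \<in> shadow E"
  by (auto simp: doubleton_in_shadow_iff)

text \<open>Two bad hyperedges on \<open>{x, y}\<close> produce three hyperedges on four vertices,
  and a third hyperedge on \<open>{x, y}\<close> would contradict
  \<open>K4_minus_isolated\<close>.\<close>

lemma card_bad_edges_le_2:
  assumes "x \<noteq> y"
  shows "card {z. z \<noteq> x \<and> z \<noteq> y \<and> {x, y, z} \<in> E \<and> (shared E {x, z} \<or> shared E {y, z})} \<le> 2"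
proof (rule card_le_2I, goal_cases)
  case (1 c d f)
  then have *: "{x, y, c} \<in> E" "{x, y, d} \<in> E" "{x, y, f} \<in> E" "distinct [x, y, c, d]" "distinct [x, y, c, d, f]"
    using assms by auto
  have "f \<notin> {x, y, c} \<union> {x, y, d} \<union> {x, c, d} \<union> {y, c, d}"
    using *(5) by auto
  then have f: "{x, y, f} \<notin> {{x, y, c}, {x, y, d}, {y, c, d}}" "{x, y, f} \<notin> {{y, x, c}, {y, x, d}, {x, c, d}}"
    by blast+
  have "{y, c, d} \<in> E \<or> {x, c, d} \<in> E"
    using 1 * by (intro two_bad_edges) auto
  then show False
  proof
    assume "{y, c, d} \<in> E"
    then show False
      using * f(1) by (intro K4_minus_isolated[of x y c d "{x, y, f}" x y]) simp_all
  next
    assume "{x, c, d} \<in> E"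
    moreover have "{y, x, c} \<in> E" "{y, x, d} \<in> E"
      using * by (simp_all add: insert_commute)
    ultimately show False
      using * not_sym[OF assms] f(2) by (intro K4_minus_isolated[of y x c d "{x, y, f}" x y]) simp_all
  qed
qed

end

section \<open>Lower bound for the size of the shadow\<close>

lemma (in berge_C4_free) card_shadow_Diff:
  assumes K: "K \<subseteq> E" and Q: "Q \<subseteq> shadow E"
    and disj: "\<And>p f. \<lbrakk>p \<in> Q; f \<in> E; p \<subseteq> f\<rbrakk> \<Longrightarrow> f \<in> K"
    and "2 * card K \<le> card Q" and "2 * card (E - K) \<le> card (shadow (E - K))"
  shows "2 * card E \<le> card (shadow E)"
proof -
  \<comment> \<open>A pair in \<open>Q\<close> lies only in hyperedges of \<open>K\<close>, so it
    vanishes from the shadow when \<open>K\<close> is removed.\<close>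
  have "shadow (E - K) \<subseteq> shadow E - Q"
    using disj by (auto simp: shadow_def)
  then have "card (shadow (E - K)) \<le> card (shadow E) - card Q"
    using finite_shadow Q by (metis card_Diff_subset card_mono finite_Diff finite_subset)
  moreover have "card E = card (E - K) + card K"
    using K finite_edges by (metis card_Diff_subset card_mono finite_subset le_add_diff_inverse2)
  moreover have "card Q \<le> card (shadow E)"
    using Q finite_shadow by (rule card_mono[rotated])
  ultimately show ?thesis
    using assms(4,5) by linarith
qed

text \<open>Remove a hyperedge with two unshared pairs; if there is none, all hyperedges are bad and some three of
  them on four vertices can be removed together with six pairs.\<close>

lemma card_shadow_ge:
  assumes "berge_C4_free E"
  shows "2 * card E \<le> card (shadow E)"
  using assms
proof (induction "card E" arbitrary: E rule: less_induct)
  case less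
  then interpret berge_C4_free E
    by simp
  have IH: "2 * card (E - K) \<le> card (shadow (E - K))" if "K \<subseteq> E" "K \<noteq> {}" for K
  proof (rule less.hyps)
    show "card (E - K) < card E"
      using that finite_edges by (intro psubset_card_mono) auto
  qed (simp add: subset_berge_C4_free)
  show ?case
  proof (cases "\<exists>x y z. {x, y, z} \<in> E \<and> distinct [x, y, z] \<and> \<not> shared E {x, y} \<and> \<not> shared E {x, z}")
    case True
    then obtain x y z where e: "{x, y, z} \<in> E" "distinct [x, y, z]"
        "\<not> shared E {x, y}" "\<not> shared E {x, z}"
      by blast
    show ?thesis
    proof (rule card_shadow_Diff)
      show "{{x, y, z}} \<subseteq> E" "{{x, y}, {x, z}} \<subseteq> shadow E"
        using e by (auto simp: doubleton_in_shadow_iff)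
      show "f \<in> {{x, y, z}}" if "p \<in> {{x, y}, {x, z}}" "f \<in> E" "p \<subseteq> f" for p f
        using that e not_sharedD[of E p f "{x, y, z}"] by blast
      show "2 * card {{x, y, z}} \<le> card {{x, y}, {x, z}}"
        using e by (simp add: doubleton_eq_iff)
      show "2 * card (E - {{x, y, z}}) \<le> card (shadow (E - {{x, y, z}}))"
        using e by (intro IH) auto
    qed
  next
    \<comment> \<open>Now at every vertex of every hyperedge one of the two pairs is shared. This is
      used once to find two hyperedges on a common pair \<open>{a, b}\<close>, and then at their
      outer vertices \<open>c\<close> and \<open>d\<close> to apply
      \<open>two_bad_edges\<close>.\<close>
    case bad: False
    show ?thesis
    proof (cases "E = {}")
      case False
      then obtain e where "e \<in> E"
        by blast
      then obtain a' b' c' where "{a', b', c'} \<in> E" "distinct [a', b', c']"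
        using card_edge[of e] by (auto simp: card_3_iff)
      then have "shared E {a', b'} \<or> shared E {a', c'}"
        using bad by blast
      then obtain a b e f where "a \<noteq> b" "e \<in> E" "a \<in> e" "b \<in> e" "f \<in> E" "f \<noteq> e" "a \<in> f" "b \<in> f"
        using \<open>distinct [a', b', c']\<close> unfolding shared_def by auto
      moreover from this obtain c where c: "e = {a, b, c}" "c \<noteq> a" "c \<noteq> b"
        using edge_obtain_third by metis
      moreover from calculation obtain d where d: "f = {a, b, d}" "d \<noteq> a" "d \<noteq> b"
        using edge_obtain_third by metis
      ultimately have abcd: "{a, b, c} \<in> E" "{a, b, d} \<in> E" "distinct [a, b, c, d]"
        by auto
      have "{c, a, b} \<in> E" "{d, a, b} \<in> E" "distinct [c, a, b]" "distinct [d, a, b]"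
        using abcd by (simp_all add: insert_commute) auto
      then have "shared E {c, a} \<or> shared E {c, b}" "shared E {d, a} \<or> shared E {d, b}"
        using bad by blast+
      then have "{b, c, d} \<in> E \<or> {a, c, d} \<in> E"
        using abcd by (intro two_bad_edges) (simp_all add: insert_commute)
      then obtain a b c d where K: "{a, b, c} \<in> E" "{a, b, d} \<in> E" "{b, c, d} \<in> E" "distinct [a, b, c, d]"
      proof
        assume "{b, c, d} \<in> E"
        then show ?thesis using that abcd by blast
      next
        assume "{a, c, d} \<in> E"
        moreover have "{b, a, c} \<in> E" "{b, a, d} \<in> E" "distinct [b, a, c, d]"
          using abcd by (simp_all add: insert_commute) auto
        ultimately show ?thesis using that by blast
      qed
      define K where "K = {{a, b, c}, {a, b, d}, {b, c, d}}"
      define Q where "Q = {{a, b}, {a, c}, {a, d}, {b, c}, {b, d}, {c, d}}"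
      show ?thesis
      proof (rule card_shadow_Diff)
        show KE: "K \<subseteq> E"
          using K by (simp add: K_def)
        show "Q \<subseteq> shadow E"
          using K(4) by (simp add: Q_def K(1-3)[THEN doubleton_in_shadowI])
        \<comment> \<open>By \<open>K4_minus_isolated\<close> no other hyperedge contains two of the
          four vertices, so all six pairs disappear together with \<open>K\<close>.\<close>
        show "f \<in> K" if "p \<in> Q" "f \<in> E" "p \<subseteq> f" for p f
        proof (rule ccontr)
          assume "f \<notin> K"
          moreover obtain x y where "p = {x, y}" "x \<noteq> y" "{x, y} \<subseteq> {a, b, c, d}"
            using \<open>p \<in> Q\<close> K(4) unfolding Q_def by (elim insertE emptyE) auto
          ultimately show False
            using that(2,3) K K4_minus_isolated[of a b c d f x y] unfolding K_def by simp
        qed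
        have "card Q = 6"
          using K(4) by (simp add: Q_def doubleton_eq_iff)
        moreover have "card K \<le> 3"
          by (simp add: K_def card_insert_if)
        ultimately show "2 * card K \<le> card Q"
          by simp
        show "2 * card (E - K) \<le> card (shadow (E - K))"
          using KE by (rule IH) (simp add: K_def)
      qed
    qed simp
  qed
qed

section \<open>Common neighbours in the shadow\<close>

context berge_C4_free
begin

definition nbrs :: "'a \<Rightarrow> 'a set" where
  "nbrs v = {u. {u, v} \<in> shadow E}"

text \<open>Paths inside a single hyperedge are excluded because they may give many common
  neighbours; there are only linearly many of them in total, and \<open>edge_triples\<close>
  accounts for them.\<close>

definition midpoints :: "'a \<Rightarrow> 'a \<Rightarrow> 'a set" where
  "midpoints u w = {v. {u, v} \<in> shadow E \<and> {v, w} \<in> shadow E \<and> {u, v, w} \<notin> E}"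

text \<open>The only obstruction to completing two midpoints \<open>v\<close>, \<open>v'\<close> of \<open>u\<close> and \<open>w\<close> to a Berge
  four-cycle is that one hyperedge must serve both \<open>{u, v}\<close> and \<open>{u, v'}\<close> (or likewise at \<open>w\<close>).\<close>

definition tight :: "'a \<Rightarrow> 'a \<Rightarrow> 'a \<Rightarrow> bool" where
  "tight u v v' \<longleftrightarrow> {u, v, v'} \<in> E \<and> \<not> shared E {u, v} \<and> \<not> shared E {u, v'}"

text \<open>If the same hyperedge covers both pairs, it is \<open>{u, v, v'}\<close>, and failure of
  tightness supplies another hyperedge for one of them.\<close>

lemma not_tightE:
  assumes "{u, v} \<in> shadow E" "{u, v'} \<in> shadow E" "v \<noteq> v'" "\<not> tight u v v'"
  obtains e e' where "e \<in> E" "e' \<in> E" "e \<noteq> e'" "u \<in> e" "v \<in> e" "u \<in> e'" "v' \<in> e'"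
proof -
  obtain e e' where e: "e \<in> E" "u \<in> e" "v \<in> e" "e' \<in> E" "u \<in> e'" "v' \<in> e'"
    using assms by (auto simp: doubleton_in_shadow_iff)
  have ne: "u \<noteq> v" "u \<noteq> v'"
    using assms by (auto simp: doubleton_in_shadow_iff)
  show ?thesis
  proof (cases "e = e'")
    case True
    then have "e = {u, v, v'}"
      using e ne assms(3) by (intro edge_eqI) auto
    then have "shared E {u, v} \<or> shared E {u, v'}"
      using assms(4) e by (auto simp: tight_def)
    then show ?thesis
    proof
      assume "shared E {u, v}"
      then obtain g where "g \<in> E" "g \<noteq> e'" "u \<in> g" "v \<in> g"
        by (rule sharedE)
      then show ?thesis
        using that e by blast
    next
      assume "shared E {u, v'}"
      then obtain g where "g \<in> E" "g \<noteq> e" "u \<in> g" "v' \<in> g"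
        by (rule sharedE)
      then show ?thesis
        using that[of e g] e by blast
    qed
  qed (use that e in blast)
qed

lemma midpoints_tight:
  assumes "u \<noteq> w" "v \<in> midpoints u w" "v' \<in> midpoints u w" "v \<noteq> v'"
  shows "tight u v v' \<or> tight w v v'"
proof (rule ccontr)
  assume n: "\<not> ?thesis"
  have sh: "{u, v} \<in> shadow E" "{u, v'} \<in> shadow E" "{w, v} \<in> shadow E" "{w, v'} \<in> shadow E"
    using assms(2,3) by (simp_all add: midpoints_def insert_commute)
  have n: "\<not> tight u v v'" "\<not> tight w v v'"
    using n by auto
  obtain e e' where e: "e \<in> E" "e' \<in> E" "e \<noteq> e'" "u \<in> e" "v \<in> e" "u \<in> e'" "v' \<in> e'"
    using sh(1,2) assms(4) n(1) by (rule not_tightE)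
  obtain f f' where f: "f \<in> E" "f' \<in> E" "f \<noteq> f'" "w \<in> f" "v \<in> f" "w \<in> f'" "v' \<in> f'"
    using sh(3,4) assms(4) n(2) by (rule not_tightE)
  have dist: "distinct [u, v, w]" "distinct [u, v', w]" "distinct [u, v, w, v']" "distinct [v', w, v, u]"
    using sh assms(1,4) by (auto simp: doubleton_in_shadow_iff)
  have n: "{u, v, w} \<notin> E" "{u, v', w} \<notin> E"
    using assms(2,3) by (simp_all add: midpoints_def)
  \<comment> \<open>A hyperedge at both \<open>u\<close> and \<open>w\<close> would either be
    \<open>{u, v, w}\<close> or \<open>{u, v', w}\<close>, excluded by \<open>midpoints\<close>, or
    contain four vertices. Hence all four hyperedges are distinct.\<close>
  have "e \<noteq> f"
    using edge_eqI[OF e(1,4,5) _ dist(1)] e(1) f(4) n(1) by metis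
  moreover have "e' \<noteq> f'"
    using edge_eqI[OF e(2,6,7) _ dist(2)] e(2) f(6) n(2) by metis
  moreover have "e \<noteq> f'"
    using edge_elem[OF e(1,4,5) _ dist(1), of v'] f(6,7) dist by auto
  moreover have "e' \<noteq> f"
    using edge_elem[OF e(2,6,7) _ dist(2), of v] f(4,5) dist by auto
  ultimately show False
    using e f dist no_C4[of e f f' e' u v w v'] by simp
qed

lemma tight_commute: "tight u v v' \<longleftrightarrow> tight u v' v"
  by (auto simp: tight_def insert_commute)

lemma tight_unique:
  assumes "tight u x y" "tight u x z"
  shows "y = z"
proof -
  have E: "{u, x, y} \<in> E" "{u, x, z} \<in> E"
    using assms by (auto simp: tight_def)
  then have "{u, x, y} = {u, x, z}"
    using assms(1) not_sharedD[of E "{u, x}"] by (auto simp: tight_def)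
  moreover have "y \<notin> {u, x}"
    using card_edge[OF E(1)] by (auto simp: card_insert_if split: if_splits)
  ultimately show ?thesis
    by blast
qed

text \<open>For a fixed end, the tight pairs form a matching by \<open>tight_unique\<close>. Among
  three midpoints, two of the three pairs would be tight at the same end, yet they share a
  vertex.\<close>

lemma card_midpoints_le_2:
  assumes "u \<noteq> w"
  shows "card (midpoints u w) \<le> 2"
proof (rule card_le_2I, goal_cases)
  case (1 x y z)
  then show ?case
    using midpoints_tight[OF assms] tight_commute tight_unique by metis
qed

lemma pagesI:
  assumes "tight u v v'" "{w, v, v'} \<in> E" "u \<noteq> w"
  shows "u \<in> pages E {v, v'}"
proof -
  have E: "{u, v, v'} \<in> E"
    using assms by (auto simp: tight_def)
  have u: "u \<notin> {v, v'}"
    using card_edge[OF E] by (auto simp: card_insert_if split: if_splits)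
  then have "{u, v, v'} \<noteq> {w, v, v'}"
    using assms(3) by blast
  then have "shared E {v, v'}"
    unfolding shared_def
    by (intro bexI[OF _ E] bexI[OF _ assms(2)] conjI) (simp_all add: subset_insertI)
  moreover have "\<not> shared E {v, u}" "\<not> shared E {v', u}"
    using assms(1) by (simp_all add: tight_def insert_commute)
  ultimately show ?thesis
    using u E unfolding pages_def by simp
qed

lemma finite_pages: "finite (pages E p)"
proof (rule finite_subset)
  show "pages E p \<subseteq> \<Union>E"
    by (auto simp: pages_def)
qed (use finite_edges finite_edge in auto)

lemma midpoints_commute: "midpoints u w = midpoints w u"
  by (auto simp: midpoints_def insert_commute)

section \<open>Counting paths of length two\<close>

definition bad_pages :: "'a \<Rightarrow> 'a \<Rightarrow> 'a set" where
  "bad_pages x y = {z. z \<noteq> x \<and> z \<noteq> y \<and> {x, y, z} \<in> E \<and> (shared E {x, z} \<or> shared E {y, z})}"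

definition page_pairs :: "('a \<times> 'a) set" where
  "page_pairs = (\<Union>p\<in>shadow E. pages E p \<times> pages E p)"

text \<open>The pair is charged to a hyperedge through \<open>u\<close>; once \<open>u\<close>,
  \<open>v\<close>, \<open>v'\<close> are fixed, at most four choices of \<open>w\<close> remain,
  which gives a bound linear in \<open>card E\<close>.\<close>

definition exceptional :: "('a \<times> 'a) set" where
  "exceptional = {(u, w). \<exists>v v'. {u, v, v'} \<in> E \<and> v \<noteq> v' \<and> w \<in> midpoints v v' \<union> bad_pages v v'}"

definition edge_triples :: "('a \<times> 'a \<times> 'a) set" where
  "edge_triples = (\<Union>e\<in>E. e \<times> e \<times> e)"

lemma finite_Union_edges: "finite (\<Union>E)"
  using finite_edges finite_edge by auto

lemma finite_edge_triples: "finite edge_triples"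
  using finite_edges finite_edge by (auto simp: edge_triples_def)

lemma card_edge_triples: "card edge_triples \<le> 27 * card E"
proof -
  have "card edge_triples \<le> (\<Sum>e\<in>E. card (e \<times> e \<times> e))"
    unfolding edge_triples_def by (rule card_UN_le) (rule finite_edges)
  also have "\<dots> = 27 * card E"
    by (simp add: card_edge card_cartesian_product)
  finally show ?thesis .
qed

text \<open>The vertex \<open>w\<close> is adjacent to \<open>v\<close> and \<open>v'\<close>. If
  \<open>{w, v, v'}\<close> is no hyperedge, \<open>w\<close> is a midpoint of them; if it is one
  with a shared pair at \<open>w\<close>, then \<open>w\<close> is a bad page; otherwise
  \<open>u\<close> and \<open>w\<close> are both pages on the spine \<open>{v, v'}\<close>.\<close>

lemma two_midpoints_aux:
  assumes "v \<in> midpoints u w" "v' \<in> midpoints u w" "v \<noteq> v'" "u \<noteq> w" "tight u v v'"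
  shows "(u, w) \<in> page_pairs \<union> exceptional"
proof -
  have E: "{u, v, v'} \<in> E"
    using assms(5) by (simp add: tight_def)
  have sh: "{v, w} \<in> shadow E" "{w, v'} \<in> shadow E" "{w, v} \<in> shadow E"
    using assms(1,2) by (simp_all add: midpoints_def insert_commute)
  then have ne: "w \<noteq> v" "w \<noteq> v'"
    by (simp_all add: doubleton_in_shadow_iff)
  show ?thesis
  proof (cases "w \<in> midpoints v v' \<union> bad_pages v v'")
    case True
    then show ?thesis
      using E assms(3) by (auto simp: exceptional_def)
  next
    case False
    have W: "{w, v, v'} \<in> E"
      using False sh by (simp add: midpoints_def insert_commute)
    then have "tight w v v'"
      using False ne by (simp add: bad_pages_def tight_def insert_commute)
    then have "w \<in> pages E {v, v'}" "u \<in> pages E {v, v'}"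
      using pagesI[OF _ E] pagesI[OF assms(5) W] assms(4) by auto
    moreover have "{v, v'} \<in> shadow E"
      using assms(3) by (intro doubleton_in_shadowI[OF E]) simp_all
    ultimately show ?thesis
      by (auto simp: page_pairs_def)
  qed
qed

lemma two_midpoints:
  assumes "u \<noteq> w" "card (midpoints u w) \<ge> 2"
  shows "(u, w) \<in> page_pairs \<union> exceptional \<union> exceptional\<inverse>"
proof -
  obtain B where "B \<subseteq> midpoints u w" "card B = 2"
    using assms(2) obtain_subset_with_card_n by metis
  then obtain v v' where v: "v \<in> midpoints u w" "v' \<in> midpoints u w" "v \<noteq> v'"
    by (auto simp: card_2_iff)
  consider "tight u v v'" | "tight w v v'"
    using midpoints_tight[OF assms(1) v] by blast
  then show ?thesis
  proof cases
    case 1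
    then show ?thesis
      using two_midpoints_aux[OF v assms(1)] by blast
  next
    case 2
    then have "(w, u) \<in> page_pairs \<union> exceptional"
      using two_midpoints_aux[of v w u v'] v assms(1) midpoints_commute by blast
    then show ?thesis
      by (auto simp: page_pairs_def)
  qed
qed

lemma midpoints_subset: "midpoints u w \<subseteq> \<Union>E"
  by (auto simp: midpoints_def doubleton_in_shadow_iff)

lemma exceptional_bound: "finite exceptional" "card exceptional \<le> 108 * card E"
proof -
  define F where "F = {(u, v, v'). {u, v, v'} \<in> E \<and> v \<noteq> v'}"
  define G where "G = Sigma F (\<lambda>(u, v, v'). midpoints v v' \<union> bad_pages v v')"
  have "F \<subseteq> edge_triples"
    by (auto simp: F_def edge_triples_def intro!: bexI)
  then have F: "finite F" "card F \<le> 27 * card E"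
    using finite_edge_triples card_edge_triples by (auto intro: finite_subset card_mono order.trans)
  have fin: "finite (midpoints v v' \<union> bad_pages v v')" for v v'
    by (rule finite_subset[OF _ finite_Union_edges])
      (use midpoints_subset in \<open>auto simp: bad_pages_def\<close>)
  have G: "finite G"
    unfolding G_def using F fin by (intro finite_SigmaI) auto
  have exc: "exceptional = (\<lambda>((u, v, v'), w). (u, w)) ` G"
    by (force simp: exceptional_def G_def F_def)
  then show "finite exceptional"
    using G by simp
  have "card exceptional \<le> card G"
    unfolding exc using G by (rule card_image_le)
  also have "\<dots> = (\<Sum>(u, v, v')\<in>F. card (midpoints v v' \<union> bad_pages v v'))"
    unfolding G_def using F fin by (subst card_SigmaI) (auto intro: sum.cong)
  \<comment> \<open>At most two midpoints and at most two bad pages.\<close>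
  also have "\<dots> \<le> (\<Sum>(u, v, v')\<in>F. 4)"
  proof (rule sum_mono, clarify)
    fix u v v' assume "(u, v, v') \<in> F"
    then have "v \<noteq> v'"
      by (simp add: F_def)
    then show "card (midpoints v v' \<union> bad_pages v v') \<le> 4"
      using card_midpoints_le_2[of v v'] card_bad_edges_le_2[of v v']
        card_Un_le[of "midpoints v v'" "bad_pages v v'"] unfolding bad_pages_def by linarith
  qed
  also have "\<dots> \<le> 108 * card E"
    using F(2) by (simp add: split_def)
  finally show "card exceptional \<le> 108 * card E" .
qed

lemma card_page_pairs_le: "finite page_pairs" "card page_pairs \<le> (\<Sum>p\<in>shadow E. (card (pages E p))\<^sup>2)"
proof -
  show "finite page_pairs"
    using finite_shadow finite_pages by (auto simp: page_pairs_def)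
  have "card page_pairs \<le> (\<Sum>p\<in>shadow E. card (pages E p \<times> pages E p))"
    unfolding page_pairs_def by (rule card_UN_le) (rule finite_shadow)
  then show "card page_pairs \<le> (\<Sum>p\<in>shadow E. (card (pages E p))\<^sup>2)"
    by (simp add: card_cartesian_product power2_eq_square)
qed

lemma nbrs_subset: "nbrs v \<subseteq> \<Union>E"
  by (auto simp: nbrs_def doubleton_in_shadow_iff)

text \<open>The left side counts paths \<open>u, v, w\<close> by their middle vertex. Those with
  \<open>u = w\<close> or inside a hyperedge number at most \<open>27 * card E\<close>; the others
  are counted by their ends. The constant is \<open>243 = 27 + 2 * 108\<close>, as
  \<open>exceptional\<close> enters in both orders.\<close>

lemma sum_card_nbrs_sq_le:
  assumes V: "finite V" "\<Union>E \<subseteq> V"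
  shows "(\<Sum>v\<in>V. (card (nbrs v))\<^sup>2) \<le> (card V)\<^sup>2 + (\<Sum>p\<in>shadow E. (card (pages E p))\<^sup>2) + 243 * card E"
proof -
  define T where "T = Sigma V (\<lambda>v. nbrs v \<times> nbrs v)"
  define W where "W = {(u, w) \<in> V \<times> V. u \<noteq> w}"
  define M where "M = Sigma W (\<lambda>(u, w). midpoints u w)"
  define X where "X = page_pairs \<union> exceptional \<union> exceptional\<inverse>"
  have fin_nbrs: "finite (nbrs v)" for v
    using nbrs_subset finite_Union_edges by (rule finite_subset)
  have fin_mid: "finite (midpoints u w)" for u w
    using midpoints_subset finite_Union_edges by (rule finite_subset)
  have W: "finite W" "card W \<le> (card V)\<^sup>2"
  proof -
    have "W \<subseteq> V \<times> V"
      by (auto simp: W_def)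
    then show "finite W" "card W \<le> (card V)\<^sup>2"
      using V(1) card_mono[of "V \<times> V" W] by (auto simp: card_cartesian_product power2_eq_square intro: finite_subset)
  qed
  have M: "finite M"
    unfolding M_def using W fin_mid by (intro finite_SigmaI) auto
  have X: "finite X" "card X \<le> (\<Sum>p\<in>shadow E. (card (pages E p))\<^sup>2) + 216 * card E"
  proof -
    show "finite X"
      using card_page_pairs_le(1) exceptional_bound(1) by (simp add: X_def)
    have "card X \<le> card page_pairs + card exceptional + card (exceptional\<inverse>)"
      unfolding X_def by (meson card_Un_le add_right_mono order.trans)
    then show "card X \<le> (\<Sum>p\<in>shadow E. (card (pages E p))\<^sup>2) + 216 * card E"
      using card_page_pairs_le(2) exceptional_bound(2) by (simp add: card_inverse)
  qed
  have "T \<subseteq> edge_triples \<union> (\<lambda>((u, w), v). (v, u, w)) ` M"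
  proof
    fix t assume t: "t \<in> T"
    obtain v u w where vuw: "t = (v, u, w)"
      by (cases t)
    then have sh: "{u, v} \<in> shadow E" "{w, v} \<in> shadow E"
      using t by (auto simp: T_def nbrs_def)
    show "t \<in> edge_triples \<union> (\<lambda>((u, w), v). (v, u, w)) ` M"
    proof (cases "u = w \<or> {u, v, w} \<in> E")
      case True
      then have "\<exists>e\<in>E. v \<in> e \<and> u \<in> e \<and> w \<in> e"
      proof
        assume "u = w"
        then show ?thesis
          using sh(1) by (auto simp: doubleton_in_shadow_iff)
      qed (rule bexI, simp_all)
      then show ?thesis
        unfolding vuw edge_triples_def by blast
    next
      case False
      have "u \<in> V" "w \<in> V"
        using sh V(2) by (auto simp: doubleton_in_shadow_iff)
      then have "((u, w), v) \<in> M"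
        using False sh by (simp add: M_def W_def midpoints_def insert_commute[of w v])
      then show ?thesis
        unfolding vuw by (intro UnI2 image_eqI[of _ _ "((u, w), v)"]) simp_all
    qed
  qed
  then have "card T \<le> card (edge_triples \<union> (\<lambda>((u, w), v). (v, u, w)) ` M)"
    using finite_edge_triples M by (intro card_mono) auto
  also have "\<dots> \<le> card edge_triples + card ((\<lambda>((u, w), v). (v, u, w)) ` M)"
    by (rule card_Un_le)
  also have "\<dots> \<le> 27 * card E + card M"
    by (intro add_mono card_edge_triples card_image_le M)
  finally have T: "card T \<le> 27 * card E + card M" .
  have "card M = (\<Sum>(u, w)\<in>W. card (midpoints u w))"
    unfolding M_def using W fin_mid by (subst card_SigmaI) (auto intro: sum.cong)
  \<comment> \<open>One midpoint is the generic case; a second one occurs only for pairs in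
    \<open>X\<close>.\<close>
  also have "\<dots> \<le> (\<Sum>q\<in>W. 1 + (if q \<in> X then 1 else 0))"
  proof (rule sum_mono, clarify)
    fix u w assume "(u, w) \<in> W"
    then have "u \<noteq> w"
      by (simp add: W_def)
    then have "card (midpoints u w) \<le> 2" "2 \<le> card (midpoints u w) \<Longrightarrow> (u, w) \<in> X"
      using card_midpoints_le_2 two_midpoints unfolding X_def by blast+
    then show "card (midpoints u w) \<le> 1 + (if (u, w) \<in> X then 1 else 0)"
      by (cases "(u, w) \<in> X") (simp, fastforce)
  qed
  also have "\<dots> = card W + card (W \<inter> X)"
    by (simp only: sum.distrib sum.If_cases[OF W(1)]) simp
  also have "\<dots> \<le> (card V)\<^sup>2 + card X"
    using W(2) X(1) by (intro add_mono card_mono) auto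
  finally have "card M \<le> (card V)\<^sup>2 + card X" .
  moreover have "card T = (\<Sum>v\<in>V. (card (nbrs v))\<^sup>2)"
    unfolding T_def using V(1) fin_nbrs by (subst card_SigmaI) (auto simp: card_cartesian_product power2_eq_square)
  ultimately show ?thesis
    using T X(2) by linarith
qed

section \<open>Sums over pages and over incidences\<close>

lemma sum_card_pages_le: "(\<Sum>p\<in>shadow E. card (pages E p)) \<le> card E"
proof -
  \<comment> \<open>A second spine \<open>q\<close> of the same hyperedge would contain
    \<open>z\<close> and a vertex of \<open>p\<close>. It would then be an outer pair of the page
    \<open>z\<close>, hence unshared, whereas spines are shared.\<close>
  have "inj_on (\<lambda>(p, z). insert z p) (Sigma (shadow E) (pages E))"
  proof (rule inj_onI, clarify)
    fix p z q y
    assume *: "p \<in> shadow E" "z \<in> pages E p" "q \<in> shadow E" "y \<in> pages E q" "insert z p = insert y q"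
    show "p = q \<and> z = y"
    proof (cases "z = y")
      case True
      then show ?thesis
        using * by (auto simp: pages_def)
    next
      case False
      then have "z \<in> q" "y \<in> p"
        using * by auto
      moreover obtain t where t: "q = {z, t}" "z \<noteq> t"
        using * \<open>z \<in> q\<close> by (auto simp: shadow_def card_2_iff doubleton_eq_iff)
      moreover have "t \<in> p"
        using * t by (auto simp: pages_def)
      ultimately have "\<not> shared E q"
        using * by (auto simp: pages_def insert_commute)
      then show ?thesis
        using * by (simp add: pages_def)
    qed
  qed
  moreover have "(\<lambda>(p, z). insert z p) ` Sigma (shadow E) (pages E) \<subseteq> E"
    by (auto simp: pages_def)
  ultimately have "card (Sigma (shadow E) (pages E)) \<le> card E"
    using finite_edges by (metis card_inj_on_le)
  then show ?thesis
    using finite_shadow finite_pages by (simp add: card_SigmaI)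
qed

lemma card_nbrs: "card (nbrs v) = card {p \<in> shadow E. v \<in> p}"
proof (rule bij_betw_same_card)
  show "bij_betw (\<lambda>u. {u, v}) (nbrs v) {p \<in> shadow E. v \<in> p}"
  proof (rule bij_betw_imageI)
    show "inj_on (\<lambda>u. {u, v}) (nbrs v)"
      by (auto simp: inj_on_def doubleton_eq_iff)
    show "(\<lambda>u. {u, v}) ` nbrs v = {p \<in> shadow E. v \<in> p}"
    proof (intro equalityI subsetI)
      fix p assume "p \<in> {p \<in> shadow E. v \<in> p}"
      then have "p \<in> shadow E" "v \<in> p" "card p = 2"
        by (auto simp: shadow_def)
      moreover from this obtain u where "p = {u, v}"
        by (auto simp: card_2_iff)
      ultimately show "p \<in> (\<lambda>u. {u, v}) ` nbrs v"
        by (auto simp: nbrs_def)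
    qed (auto simp: nbrs_def)
  qed
qed

text \<open>A page \<open>z\<close> common to two spines through \<open>v\<close> would make the
  outer pair \<open>{v, z}\<close> shared; so the page sets are disjoint, and they consist of
  neighbours of \<open>v\<close>.\<close>

lemma sum_card_pages_at_le: "(\<Sum>p\<in>{p \<in> shadow E. v \<in> p}. card (pages E p)) \<le> card (nbrs v)"
proof -
  have "pages E p \<inter> pages E q = {}" if "p \<in> shadow E" "v \<in> p" "q \<in> shadow E" "v \<in> q" "p \<noteq> q" for p q
  proof (rule ccontr)
    assume "pages E p \<inter> pages E q \<noteq> {}"
    then obtain z where z: "z \<in> pages E p" "z \<in> pages E q"
      by blast
    then have "insert z p \<noteq> insert z q"
      using that by (auto simp: pages_def)
    then have "shared E {v, z}"
      using z that unfolding shared_def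
      by (intro bexI[of _ "insert z p"] bexI[of _ "insert z q"] conjI) (auto simp: pages_def)
    then show False
      using z that by (auto simp: pages_def)
  qed
  then have "(\<Sum>p\<in>{p \<in> shadow E. v \<in> p}. card (pages E p)) = card (\<Union>p\<in>{p \<in> shadow E. v \<in> p}. pages E p)"
    using finite_shadow finite_pages by (subst card_UN_disjoint) auto
  also have "\<dots> \<le> card (nbrs v)"
  proof (rule card_mono)
    show "finite (nbrs v)"
      using nbrs_subset finite_Union_edges by (rule finite_subset)
    show "(\<Union>p\<in>{p \<in> shadow E. v \<in> p}. pages E p) \<subseteq> nbrs v"
      by (auto simp: pages_def nbrs_def doubleton_in_shadow_iff)
  qed
  finally show ?thesis .
qed

lemma sum_over_incidences:
  fixes f :: "'a set \<Rightarrow> real"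
  assumes "finite V" "\<Union>E \<subseteq> V"
  shows "(\<Sum>v\<in>V. \<Sum>p\<in>{p \<in> shadow E. v \<in> p}. f p) = 2 * (\<Sum>p\<in>shadow E. f p)"
proof -
  have "{v \<in> V. v \<in> p} = p" "card p = 2" if "p \<in> shadow E" for p
    using that assms(2) by (auto simp: shadow_def)
  then have "(\<Sum>p\<in>shadow E. \<Sum>v\<in>{v \<in> V. v \<in> p}. f p) = (\<Sum>p\<in>shadow E. 2 * f p)"
    by (intro sum.cong) simp_all
  then show ?thesis
    using sum.swap_restrict[OF assms(1) finite_shadow, of "\<lambda>_. f" "\<lambda>v p. v \<in> p"]
    by (simp add: sum_distrib_left)
qed

end

section \<open>Weights and the Cauchy-Schwarz inequality\<close>

lemma weight_sq_le:
  fixes N :: real and D :: "'b \<Rightarrow> real"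
  assumes "\<And>i. i \<in> I \<Longrightarrow> D i \<ge> 0" "sum D I \<le> N"
  shows "(N - (1 - 1 / sqrt 2) * sum D I)\<^sup>2 \<le> N\<^sup>2 - (\<Sum>i\<in>I. (D i)\<^sup>2) / 2"
proof -
  define S where "S = sum D I"
  \<comment> \<open>With this value the inequality is an equality when \<open>N = S\<close> and a
    single \<open>D i\<close> makes up the whole sum.\<close>
  define c :: real where "c = 1 / sqrt 2"
  have c: "c\<^sup>2 = 1 / 2" "c \<le> 1"
    by (auto simp: c_def power_divide)
  have S: "S \<ge> 0"
    unfolding S_def using assms(1) by (rule sum_nonneg)
  have "L2_set D I \<le> S"
    unfolding S_def using assms(1) by (rule L2_set_le_sum)
  then have "(\<Sum>i\<in>I. (D i)\<^sup>2) \<le> S\<^sup>2"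
    unfolding L2_set_def by (rule sqrt_le_D)
  moreover have "(N - (1 - c) * S)\<^sup>2 = N\<^sup>2 - S\<^sup>2 / 2 - 2 * (1 - c) * S * (N - S) + (c\<^sup>2 - 1 / 2) * S\<^sup>2"
    by (simp add: power2_eq_square algebra_simps)
  moreover have "2 * (1 - c) * S * (N - S) \<ge> 0"
    using S c assms(2) by (simp add: S_def)
  ultimately show ?thesis
    unfolding S_def[symmetric] c_def[symmetric] using c(1) by simp
qed

lemma (in berge_C4_free) card_edges_le:
  assumes V: "finite V" "\<Union>E \<subseteq> V"
  shows "(2 + sqrt 2) * card E \<le> real (card V) powr (3/2) + 81 * card V"
proof -
  define m n where "m = real (card E)" and "n = real (card V)"
  define D where "D p = real (card (pages E p))" for p
  define N where "N v = real (card (nbrs v))" for v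
  define w where "w v = N v - (1 - 1 / sqrt 2) * (\<Sum>p\<in>{p \<in> shadow E. v \<in> p}. D p)" for v
  define M where "M = (2 + sqrt 2) * m"
  have w_sq: "(w v)\<^sup>2 \<le> (N v)\<^sup>2 - (\<Sum>p\<in>{p \<in> shadow E. v \<in> p}. (D p)\<^sup>2) / 2" for v
    unfolding w_def
  proof (rule weight_sq_le)
    show "(\<Sum>p\<in>{p \<in> shadow E. v \<in> p}. D p) \<le> N v"
      using sum_card_pages_at_le[of v] unfolding D_def N_def by (metis of_nat_le_iff of_nat_sum)
  qed (simp add: D_def)
  have "(\<Sum>v\<in>V. (w v)\<^sup>2) \<le> (\<Sum>v\<in>V. (N v)\<^sup>2 - (\<Sum>p\<in>{p \<in> shadow E. v \<in> p}. (D p)\<^sup>2) / 2)"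
    by (rule sum_mono) (rule w_sq)
  also have "\<dots> = (\<Sum>v\<in>V. (N v)\<^sup>2) - (\<Sum>p\<in>shadow E. (D p)\<^sup>2)"
    using sum_over_incidences[OF V, of "\<lambda>p. (D p)\<^sup>2"]
    by (simp add: sum_subtractf flip: sum_divide_distrib)
  also have "\<dots> \<le> n\<^sup>2 + 243 * m"
    using sum_card_nbrs_sq_le[OF V, THEN of_nat_mono, where ?'a = real]
    by (simp add: N_def D_def n_def m_def)
  finally have sq: "(\<Sum>v\<in>V. (w v)\<^sup>2) \<le> n\<^sup>2 + 243 * m" .
  \<comment> \<open>With at least \<open>2 * m\<close> shadow edges and at most \<open>m\<close>
    pages, the total weight is at least \<open>4 * m - (2 - sqrt 2) * m = M\<close>.\<close>
  have "(\<Sum>v\<in>V. w v) = 2 * card (shadow E) - (2 - sqrt 2) * (\<Sum>p\<in>shadow E. D p)"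
  proof -
    have "N v = (\<Sum>p\<in>{p \<in> shadow E. v \<in> p}. 1)" for v
      by (simp add: N_def card_nbrs)
    then have "(\<Sum>v\<in>V. N v) = 2 * card (shadow E)"
      using sum_over_incidences[OF V, of "\<lambda>_. 1"] by simp
    moreover have "2 * (1 - 1 / sqrt 2) = 2 - sqrt (2::real)"
      by (simp add: field_simps)
    ultimately show ?thesis
      using sum_over_incidences[OF V, of D]
      by (simp add: w_def sum_subtractf flip: sum_distrib_left)
  qed
  moreover have "(\<Sum>p\<in>shadow E. D p) \<le> m"
    using sum_card_pages_le unfolding D_def m_def by (metis of_nat_le_iff of_nat_sum)
  then have "(2 - sqrt 2) * (\<Sum>p\<in>shadow E. D p) \<le> (2 - sqrt 2) * m"
    by (intro mult_left_mono) (auto simp: real_le_lsqrt)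
  moreover have "2 * m \<le> card (shadow E)"
    using card_shadow_ge[OF berge_C4_free_axioms] unfolding m_def by linarith
  ultimately have "M \<le> (\<Sum>v\<in>V. w v)"
    by (simp add: M_def algebra_simps)
  moreover have M0: "M \<ge> 0" "m \<ge> 0" "n \<ge> 0"
    by (simp_all add: M_def m_def n_def)
  ultimately have "M\<^sup>2 \<le> (\<Sum>v\<in>V. w v)\<^sup>2"
    by (intro power_mono)
  also have "\<dots> \<le> (\<Sum>v\<in>V. (w v)\<^sup>2) * n"
    using Cauchy_Schwarz_ineq_sum[of w "\<lambda>_. 1" V] by (simp add: n_def)
  also have "\<dots> \<le> (n\<^sup>2 + 243 * m) * n"
    using sq M0 by (intro mult_right_mono)
  \<comment> \<open>Since \<open>3 * m \<le> M\<close>, the error \<open>243 * m\<close> becomes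
    \<open>81 * M\<close>, leaving a quadratic inequality in \<open>M\<close> alone.\<close>
  also have "\<dots> \<le> (n\<^sup>2 + 81 * M) * n"
  proof -
    have "(1::real) \<le> sqrt 2"
      by simp
    then have "3 * m \<le> M"
      using M0 unfolding M_def by (intro mult_right_mono) auto
    then show ?thesis
      using M0 by (intro mult_right_mono) auto
  qed
  finally have main: "M * (M - 81 * n) \<le> n ^ 3"
    by (simp add: power2_eq_square power3_eq_cube algebra_simps)
  define r where "r = n powr (3/2)"
  have r: "r \<ge> 0" "r * r = n ^ 3"
    using M0(3) by (simp_all add: r_def flip: powr_add powr_numeral) 
  \<comment> \<open>Otherwise both factors of \<open>M * (M - 81 * n)\<close> exceed
    \<open>r\<close>, and their product exceeds \<open>n ^ 3\<close>.\<close>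
  have "M \<le> r + 81 * n"
  proof (rule ccontr)
    assume "\<not> ?thesis"
    then have "r < M - 81 * n" "r < M"
      using M0 by auto
    then have "r * r < M * (M - 81 * n)"
      using r by (intro mult_strict_mono) auto
    then show False
      using main r by simp
  qed
  then show ?thesis
    by (simp add: M_def m_def n_def r_def)
qed

section \<open>Transfer to the extremal number\<close>

lemma berge_C4_free_hypergraph:
  assumes "uniform_hypergraph 3 V E" "berge_cycle_free V E 4"
  shows "berge_C4_free E"
proof
  have V: "finite V" "\<And>e. e \<in> E \<Longrightarrow> e \<subseteq> V" "\<And>e. e \<in> E \<Longrightarrow> card e = 3"
    using assms(1) by (auto simp: uniform_hypergraph_def)
  show "finite E"
    using V by (intro finite_subset[of E "Pow V"]) auto
  show "card e = 3" if "e \<in> E" for e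
    using V(3) that .
  fix e1 e2 e3 e4 a b c d
  assume *: "e1 \<in> E" "e2 \<in> E" "e3 \<in> E" "e4 \<in> E"
      "a \<in> e1" "b \<in> e1" "b \<in> e2" "c \<in> e2" "c \<in> e3" "d \<in> e3" "d \<in> e4" "a \<in> e4"
      "distinct [a, b, c, d]" "distinct [e1, e2, e3, e4]"
  have l4: "{..<4} = {0, 1, 2, 3::nat}"
    by auto
  have "berge_cycle V E 4 (\<lambda>i. [a, b, c, d] ! i) (\<lambda>i. [e1, e2, e3, e4] ! i)"
    unfolding berge_cycle_def
  proof (intro conjI)
    show "inj_on (\<lambda>i. [a, b, c, d] ! i) {..<4}"
      by (rule inj_on_nth[OF *(13)]) simp
    show "inj_on (\<lambda>i. [e1, e2, e3, e4] ! i) {..<4}"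
      by (rule inj_on_nth[OF *(14)]) simp
    show "(\<lambda>i. [a, b, c, d] ! i) ` {..<4} \<subseteq> V"
      using *(1-12) V(2) unfolding l4 by simp blast
    show "(\<lambda>i. [e1, e2, e3, e4] ! i) ` {..<4} \<subseteq> E"
      using *(1-4) unfolding l4 by simp
    have "\<forall>i\<in>{..<4}. {[a, b, c, d] ! i, [a, b, c, d] ! (Suc i mod 4)} \<subseteq> [e1, e2, e3, e4] ! i"
      using *(5-12) unfolding l4 by simp
    then show "\<forall>i<4. {[a, b, c, d] ! i, [a, b, c, d] ! (Suc i mod 4)} \<subseteq> [e1, e2, e3, e4] ! i"
      by simp
  qed
  then show False
    using assms(2) by (auto simp: berge_cycle_free_def)
qed

theorem theorem1:
  shows "\<exists>C::real. C > 0 \<and>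
    (\<forall>n::nat. n \<ge> 1 \<longrightarrow>
      real (ex_berge_cycle 3 n 4) \<le> real n powr (3/2) / (2 + sqrt 2) + C * real n)"
proof (intro exI[of _ "81 / (2 + sqrt 2)"] conjI allI impI)
  show "(0::real) < 81 / (2 + sqrt 2)"
    by (simp add: add_pos_nonneg)
  fix n :: nat
  have "ex_berge_cycle 3 n 4 \<in> {card E |(V :: nat set) E. uniform_hypergraph 3 V E \<and> card V = n \<and> berge_cycle_free V E 4}"
    unfolding ex_berge_cycle_def
    by (intro Max_in finite_hypergraph_sizes hypergraph_sizes_nonempty) simp
  then obtain V :: "nat set" and E where E: "ex_berge_cycle 3 n 4 = card E" "card V = n"
      and H: "uniform_hypergraph 3 V E" "berge_cycle_free V E 4"
    by auto
  interpret berge_C4_free E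
    using H by (rule berge_C4_free_hypergraph)
  have V: "finite V" "\<Union>E \<subseteq> V"
    using H(1) by (auto simp: uniform_hypergraph_def)
  \<comment> \<open>Division by \<open>2 + sqrt 2\<close> turns the linear term
    \<open>81 * n\<close> into the chosen constant.\<close>
  have "(2 + sqrt 2) * card E \<le> real n powr (3/2) + 81 * n"
    using card_edges_le[OF V] E(2) by simp
  moreover have "(0::real) < 2 + sqrt 2"
    by (simp add: add_pos_nonneg)
  ultimately show "real (ex_berge_cycle 3 n 4) \<le> real n powr (3/2) / (2 + sqrt 2) + 81 / (2 + sqrt 2) * real n"
    unfolding E(1) by (simp add: pos_le_divide_eq mult.commute flip: add_divide_distrib)
qed

end
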